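(* Assume: (A1) for any given $d\in\mathbb{R}^r$, $h(u,d)$ is differentiable in $u$; (A2) for any given $d\in\mathbb{R}^r$, $\tilde\Phi(u)=\Phi(u,h(u,d))$ is $M$-Lipschitz and $L$-smooth (its gradient is $L$-Lipschitz) in $u$, with $\tilde\Phi^*=\inf_{u\in\mathbb{R}^p}\tilde\Phi(u)>-\infty$; (A3) $\Phi(u,y)$ is $M_\Phi$-Lipschitz in $y$. Consider the deterministic model-based controller with approximate sensitivities in closed loop with the plant, $$w_{k+1}=w_k-\eta\big(\nabla_u\Phi(w_k,y_k)+\hat H_k\nabla_y\Phi(w_k,y_k)\big),\qquad y_k=h(w_k,d),\quad k\in\mathbb{N},$$ (so the applied input is $u_k=w_k$) with $0<\eta\le 1/(4L)$. Then for every $T\in\mathbb{N}_+$, $$\frac1T\sum_{k=0}^{T-1}\|\nabla\tilde\Phi(w_k)\|^2\le\frac{4(\tilde\Phi(w_0)-\tilde\Phi^* )}{\eta T}+\frac{3M_\Phi^2}{T}\sum_{k=0}^{T-1}\epsilon_{H,k}^2,\qquad \epsilon_{H,k}=\|\hat H_k-\nabla_uh(w_k,d)\|.$$ Moreover, when $\eta=1/(4L)$, the order of the right-hand side (and hence of $\frac1T\sum_{k=0}^{T-1}\|\nabla\tilde\Phi(w_k)\|^2$) depends on the quality of the $\hat H_k$ as follows: - $\mathcal{O}\big(1/T^{\min(1,2\theta)}\big)$ if $\epsilon_{H,k}\le\bar\epsilon'/(k+1)^\theta$ for all $k\in\mathbb{N}$, with $\bar\epsilon'>0$, $\theta\ge\frac13$,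 $\theta\ne\frac12$; - $\mathcal{O}\big(\ln T/T\big)$ if $\epsilon_{H,k}\le\bar\epsilon'/(k+1)^\theta$ for all $k\in\mathbb{N}$, with $\bar\epsilon'>0$, $\theta=\frac12$; - $\mathcal{O}\big(1/T+\bar\epsilon^2\big)$ if $\epsilon_{H,k}\le\bar\epsilon$ for all $k\in\mathbb{N}$, with $\bar\epsilon>0$; - $\mathcal{O}\big(1/T^{2\theta}\big)$ if $\epsilon_{H,k}\le\bar\epsilon'/(k+1)^\theta$ for all $k\in\mathbb{N}$, with $\bar\epsilon'>0$, $\theta\in(0,\frac13)$.
   Context: $p,q,r$ are positive integers, $\Phi:\mathbb{R}^p\times\mathbb{R}^q\to\mathbb{R}$ is a (possibly nonconvex) differentiable objective, $h:\mathbb{R}^p\times\mathbb{R}^r\to\mathbb{R}^q$ is the steady-state input-output map of a plant, $d\in\mathbb{R}^r$ is a fixed disturbance, $\hat H_k\in\mathbb{R}^{p\times q}$ are arbitrary approximate sensitivities, and $w_0\in\mathbb{R}^p$. $\nabla_u\Phi,\nabla_y\Phi$ are partial gradients and $\nabla_uh(u,d)\in\mathbb{R}^{p\times q}$ is the transposed Jacobian of $h$ in $u$, so $\nabla\tilde\Phi(u)=\nabla_u\Phi(u,y)+\nabla_uh(u,d)\nabla_y\Phi(u,y)$ at $y=h(u,d)$. Norms are Euclidean (induced norm for matrices). $\mathbb{N}=\{0,1,\dots\}$, $\mathbb{N}_+=\{1,2,\dots\}$. $\mathcal{O}(\cdot)$: up to a multiplicative constant independent of $T$ and $p$ (and, in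 the bounded-error case, of $\bar\epsilon$), depending only on $L,M_\Phi,\bar\epsilon',\theta,\tilde\Phi(w_0)-\tilde\Phi^*$, for all sufficiently large $T$. *)

theory Defs
  imports "HOL-Analysis.Analysis"
begin

definition gradient :: "('a::real_inner \<Rightarrow> real) \<Rightarrow> 'a \<Rightarrow> 'a" where
  "gradient f x = (THE g. GDERIV f x :> g)"

definition grad_u :: "((real^'p) \<times> (real^'q) \<Rightarrow> real) \<Rightarrow> real^'p \<Rightarrow> real^'q \<Rightarrow> real^'p" where
  "grad_u \<Phi> u y = gradient (\<lambda>u'. \<Phi> (u', y)) u"

definition grad_y :: "((real^'p) \<times> (real^'q) \<Rightarrow> real) \<Rightarrow> real^'p \<Rightarrow> real^'q \<Rightarrow> real^'q" where
  "grad_y \<Phi> u y = gradient (\<lambda>y'. \<Phi> (u, y')) y"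

(* The transposed Jacobian of h(., d); real^'q^'p is the type of matrices with
   'p rows and 'q columns. *)
definition sensitivity :: "((real^'p) \<times> (real^'r) \<Rightarrow> real^'q) \<Rightarrow> real^'r \<Rightarrow> real^'p \<Rightarrow> real^'q^'p" where
  "sensitivity h d u = transpose (jacobian (\<lambda>u'. h (u', d)) (at u))"

definition reduced_obj ::
    "((real^'p) \<times> (real^'q) \<Rightarrow> real) \<Rightarrow> ((real^'p) \<times> (real^'r) \<Rightarrow> real^'q) \<Rightarrow> real^'r \<Rightarrow> real^'p \<Rightarrow> real" where
  "reduced_obj \<Phi> h d u = \<Phi> (u, h (u, d))"

definition initial_gap ::
    "((real^'p) \<times> (real^'q) \<Rightarrow> real) \<Rightarrow> ((real^'p) \<times> (real^'r) \<Rightarrow> real^'q) \<Rightarrow> real^'r \<Rightarrow> real^'p \<Rightarrow> real" where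
  "initial_gap \<Phi> h d w0 = reduced_obj \<Phi> h d w0 - (INF u. reduced_obj \<Phi> h d u)"

(* The standing assumptions for the given disturbance d.  The finite-infimum
   assumption is bdd_below, since INF over the reals is only meaningful then. *)
definition steady_state_problem ::
    "((real^'p) \<times> (real^'q) \<Rightarrow> real) \<Rightarrow> ((real^'p) \<times> (real^'r) \<Rightarrow> real^'q) \<Rightarrow> real^'r
      \<Rightarrow> real \<Rightarrow> real \<Rightarrow> real \<Rightarrow> bool" where
  "steady_state_problem \<Phi> h d L M M\<Phi> \<longleftrightarrow>
     \<Phi> differentiable_on UNIV \<and>
     (\<lambda>u. h (u, d)) differentiable_on UNIV \<and>
     M-lipschitz_on UNIV (reduced_obj \<Phi> h d) \<and>
     reduced_obj \<Phi> h d differentiable_on UNIV \<and>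
     L-lipschitz_on UNIV (gradient (reduced_obj \<Phi> h d)) \<and>
     bdd_below (range (reduced_obj \<Phi> h d)) \<and>
     (\<forall>u. M\<Phi>-lipschitz_on UNIV (\<lambda>y. \<Phi> (u, y)))"

definition closed_loop ::
    "((real^'p) \<times> (real^'q) \<Rightarrow> real) \<Rightarrow> ((real^'p) \<times> (real^'r) \<Rightarrow> real^'q) \<Rightarrow> real^'r
      \<Rightarrow> (nat \<Rightarrow> real^'q^'p) \<Rightarrow> real \<Rightarrow> real^'p \<Rightarrow> (nat \<Rightarrow> real^'p) \<Rightarrow> (nat \<Rightarrow> real^'q) \<Rightarrow> bool" where
  "closed_loop \<Phi> h d H \<eta> w0 w y \<longleftrightarrow>
     w 0 = w0 \<and>
     (\<forall>k. y k = h (w k, d)) \<and>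
     (\<forall>k. w (Suc k) = w k - \<eta> *\<^sub>R (grad_u \<Phi> (w k) (y k) + H k *v grad_y \<Phi> (w k) (y k)))"

definition sens_error ::
    "((real^'p) \<times> (real^'r) \<Rightarrow> real^'q) \<Rightarrow> real^'r \<Rightarrow> (nat \<Rightarrow> real^'q^'p) \<Rightarrow> (nat \<Rightarrow> real^'p) \<Rightarrow> nat \<Rightarrow> real" where
  "sens_error h d H w k = onorm ((*v) (H k - sensitivity h d (w k)))"

definition avg_sq_grad ::
    "((real^'p) \<times> (real^'q) \<Rightarrow> real) \<Rightarrow> ((real^'p) \<times> (real^'r) \<Rightarrow> real^'q) \<Rightarrow> real^'r
      \<Rightarrow> (nat \<Rightarrow> real^'p) \<Rightarrow> nat \<Rightarrow> real" where
  "avg_sq_grad \<Phi> h d w T = (\<Sum>k<T. (norm (gradient (reduced_obj \<Phi> h d) (w k)))\<^sup>2) / real T"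

(* The right-hand side of the convergence bound, as a function of the initial gap \<Delta> and
   the sequence e of sensitivity errors.  No dimension occurs in it: a constant C chosen in
   terms of L, M\<Phi>, \<Delta> such that error_bound M\<Phi> \<Delta> (1/(4*L)) e T \<le> C * \<rho> T for all nonnegative
   sequences e of a given quality is a constant independent of 'p, 'q, 'r and of the problem
   data.  This is how independence of the dimension is expressed, as it cannot be stated by a
   quantifier over types. *)
definition error_bound :: "real \<Rightarrow> real \<Rightarrow> real \<Rightarrow> (nat \<Rightarrow> real) \<Rightarrow> nat \<Rightarrow> real" where
  "error_bound M\<Phi> \<Delta> \<eta> e T = 4 * \<Delta> / (\<eta> * real T) + 3 * M\<Phi>\<^sup>2 / real T * (\<Sum>k<T. (e k)\<^sup>2)"

end

theory Submission
  imports Defs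
begin

text \<open>
  By the chain rule the update direction differs from the gradient of the reduced objective by
  the sensitivity error applied to the partial gradient in \<open>y\<close>, whose norm is at most
  \<open>M\<Phi>\<close>. So the controller is inexact gradient descent: the descent lemma bounds the decrease in
  each step, and the bounds telescope. The rates follow by estimating the sum of
  \<open>(k + 1) powr - a\<close>, where \<open>a = 2 * \<theta>\<close>.
\<close>

section \<open>Gradients\<close>

text \<open>Riesz representation: a real linear functional \<open>f'\<close> is the inner product
  with \<open>adjoint f' 1\<close>. A vector is determined by its inner products with all others, so
  the \<open>THE\<close> in \<open>gradient\<close> is well defined.\<close>

lemma GDERIV_gradient:
  fixes f :: "'a::euclidean_space \<Rightarrow> real"
  assumes "f differentiable (at x)"
  shows "GDERIV f x :> gradient f x"
proof -
  obtain f' where f': "(f has_derivative f') (at x)"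
    using assms by (auto simp: differentiable_def)
  then have lin: "linear f'" by (rule has_derivative_linear)
  have "f' = (\<lambda>h. h \<bullet> adjoint f' 1)"
    using adjoint_works[OF lin] by (auto simp: fun_eq_iff)
  then have D: "GDERIV f x :> adjoint f' 1"
    using f' by (simp add: gderiv_def)
  have "g = adjoint f' 1" if "GDERIV f x :> g" for g
  proof -
    have "(\<lambda>h. h \<bullet> g) = (\<lambda>h. h \<bullet> adjoint f' 1)"
      using that D unfolding gderiv_def by (rule has_derivative_unique)
    then show ?thesis by (simp only: fun_eq_iff vector_eq_ldot)
  qed
  with D show ?thesis
    unfolding gradient_def by (rule theI)
qed

lemma gradient_eqI:
  fixes f :: "'a::euclidean_space \<Rightarrow> real"
  assumes "GDERIV f x :> g"
  shows "gradient f x = g"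
proof -
  have "GDERIV f x :> gradient f x"
    using assms by (intro GDERIV_gradient) (auto simp: gderiv_def differentiable_def)
  with assms have "(\<lambda>h. h \<bullet> gradient f x) = (\<lambda>h. h \<bullet> g)"
    unfolding gderiv_def by (metis has_derivative_unique)
  then show ?thesis by (simp only: fun_eq_iff vector_eq_ldot)
qed

text \<open>Restriction to a line reduces the two estimates that follow to calculus in one real
  variable.\<close>

lemma GDERIV_along_line:
  fixes f :: "'a::real_inner \<Rightarrow> real"
  assumes "GDERIV f (x + t *\<^sub>R d) :> g"
  shows "((\<lambda>t. f (x + t *\<^sub>R d)) has_real_derivative d \<bullet> g) (at t)"
proof -
  have "((\<lambda>t. x + t *\<^sub>R d) has_derivative (\<lambda>s. s *\<^sub>R d)) (at t)"
    by (auto intro!: derivative_eq_intros)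
  from has_derivative_compose[OF this, of f "\<lambda>h. h \<bullet> g"] assms
  show ?thesis by (simp add: gderiv_def has_field_derivative_def mult_commute_abs)
qed

text \<open>In the direction of the gradient \<open>g\<close> itself the difference quotient tends
  to \<open>g \<bullet> g\<close>, while the Lipschitz condition keeps it below
  \<open>M * norm g\<close>; cancelling \<open>norm g\<close> leaves the bound.\<close>

lemma norm_gradient_le_lipschitz:
  fixes f :: "'a::euclidean_space \<Rightarrow> real"
  assumes lip: "M-lipschitz_on UNIV f" and diff: "f differentiable (at x)"
  shows "norm (gradient f x) \<le> M"
proof -
  define g where "g = gradient f x"
  have "GDERIV f (x + 0 *\<^sub>R g) :> g"
    using GDERIV_gradient[OF diff] by (simp add: g_def)
  from GDERIV_along_line[OF this]
  have lim: "((\<lambda>t. (f (x + t *\<^sub>R g) - f x) / t) \<longlongrightarrow> g \<bullet> g) (at 0)"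
    by (simp add: DERIV_def)
  have "eventually (\<lambda>t. (f (x + t *\<^sub>R g) - f x) / t \<le> M * norm g) (at 0)"
  proof (rule eventually_at_filter[THEN iffD2], rule always_eventually, intro allI impI)
    fix t :: real assume "t \<noteq> 0"
    have "\<bar>f (x + t *\<^sub>R g) - f x\<bar> \<le> M * (\<bar>t\<bar> * norm g)"
      using lipschitz_onD[OF lip, of "x + t *\<^sub>R g" x] by (simp add: dist_norm)
    then have "\<bar>(f (x + t *\<^sub>R g) - f x) / t\<bar> \<le> M * norm g"
      using \<open>t \<noteq> 0\<close> by (simp add: abs_divide field_simps)
    then show "(f (x + t *\<^sub>R g) - f x) / t \<le> M * norm g" by linarith
  qed
  from tendsto_upperbound[OF lim this] have "norm g * norm g \<le> M * norm g"
    by (simp add: dot_square_norm power2_eq_square)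
  \<comment> \<open>Settles the case \<open>g = 0\<close>, where \<open>norm g\<close> cannot be
    cancelled.\<close>
  moreover have "0 \<le> M" using lip by (rule lipschitz_on_nonneg)
  ultimately show ?thesis
    by (cases "g = 0") (auto simp: g_def)
qed

lemma descent_lemma:
  fixes f :: "'a::euclidean_space \<Rightarrow> real"
  assumes diff: "f differentiable_on UNIV"
    and lip: "L-lipschitz_on UNIV (gradient f)"
  shows "f (x + d) \<le> f x + d \<bullet> gradient f x + L / 2 * (norm d)\<^sup>2"
proof -
  \<comment> \<open>\<open>\<phi>\<close> is \<open>f\<close> along the segment minus the linear and
    quadratic terms of the bound, so the claim becomes \<open>\<phi> 1 \<le> \<phi> 0\<close>. The
    sign of its derivative replaces an integral of the gradient.\<close>
  define \<phi> where "\<phi> t = f (x + t *\<^sub>R d) - t * (d \<bullet> gradient f x) - L / 2 * t\<^sup>2 * (norm d)\<^sup>2" for t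
  have "\<phi> 1 \<le> \<phi> 0"
  proof (rule DERIV_nonpos_imp_nonincreasing[of 0 1 \<phi>])
    fix t :: real assume t: "0 \<le> t" "t \<le> 1"
    let ?D = "d \<bullet> gradient f (x + t *\<^sub>R d) - d \<bullet> gradient f x - L * t * (norm d)\<^sup>2"
    have "GDERIV f (x + t *\<^sub>R d) :> gradient f (x + t *\<^sub>R d)"
      using diff by (intro GDERIV_gradient) (auto simp: differentiable_on_def)
    from GDERIV_along_line[OF this] have "(\<phi> has_real_derivative ?D) (at t)"
      unfolding \<phi>_def by (auto intro!: derivative_eq_intros)
    \<comment> \<open>Cauchy-Schwarz, then the Lipschitz gradient over the distance
      \<open>t * norm d\<close>.\<close>
    moreover have "d \<bullet> (gradient f (x + t *\<^sub>R d) - gradient f x) \<le> norm d * (L * (t * norm d))"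
      using lipschitz_onD[OF lip, of "x + t *\<^sub>R d" x] t
      by (intro order_trans[OF norm_cauchy_schwarz] mult_left_mono) (auto simp: dist_norm)
    then have "?D \<le> 0"
      by (simp add: inner_diff_right power2_eq_square algebra_simps)
    ultimately show "\<exists>y. (\<phi> has_real_derivative y) (at t) \<and> y \<le> 0" by blast
  qed simp
  then show ?thesis by (simp add: \<phi>_def)
qed

section \<open>Inexact gradient descent\<close>

text \<open>The descent lemma is applied to the actual step \<open>- \<eta> *\<^sub>R v\<close>, and
  \<open>v\<close> is split into the true gradient \<open>g\<close> and an error \<open>e\<close>.
  The difference of function values is kept explicit so that the bounds telescope.\<close>

lemma inexact_descent_step:
  fixes f :: "'a::euclidean_space \<Rightarrow> real"
  assumes diff: "f differentiable_on UNIV"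
    and lip: "L-lipschitz_on UNIV (gradient f)"
    and \<eta>: "0 < \<eta>" "L * \<eta> \<le> 1 / 4"
  shows "\<eta> * (norm (gradient f x))\<^sup>2
      \<le> 4 * (f x - f (x - \<eta> *\<^sub>R v)) + 3 * \<eta> * (norm (v - gradient f x))\<^sup>2"
proof -
  define g where "g = gradient f x"
  define e where "e = v - g"
  have v: "v = g + e" by (simp add: e_def)
  have "f (x - \<eta> *\<^sub>R v) \<le> f x - \<eta> * (v \<bullet> g) + L / 2 * (\<eta>\<^sup>2 * (norm v)\<^sup>2)"
    using descent_lemma[OF diff lip, of x "- (\<eta> *\<^sub>R v)"]
    by (simp add: g_def power_mult_distrib)
  also have "L / 2 * (\<eta>\<^sup>2 * (norm v)\<^sup>2) = (L * \<eta>) * (\<eta> / 2 * (norm v)\<^sup>2)"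
    by (simp add: power2_eq_square)
  \<comment> \<open>The step-size bound enters here: it turns the quadratic term into an eighth of
    \<open>\<eta> * (norm v)\<^sup>2\<close>.\<close>
  also have "\<dots> \<le> 1 / 4 * (\<eta> / 2 * (norm v)\<^sup>2)"
    using \<eta> by (intro mult_right_mono) auto
  finally have step: "f (x - \<eta> *\<^sub>R v) \<le> f x - \<eta> * (v \<bullet> g - (norm v)\<^sup>2 / 8)"
    by (simp add: algebra_simps)
  have "0 \<le> g \<bullet> g + 2 * (g \<bullet> e) + e \<bullet> e"
    using inner_ge_zero[of "g + e"]
    by (simp add: inner_add_left inner_add_right inner_commute[of e g])
  moreover have "v \<bullet> g = g \<bullet> g + g \<bullet> e"
    and "(norm v)\<^sup>2 = g \<bullet> g + 2 * (g \<bullet> e) + e \<bullet> e"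
    by (simp_all add: v power2_norm_eq_inner inner_add_left inner_add_right inner_commute[of e g])
  \<comment> \<open>Right side minus left side equals 3/8 of the squared norm of
    \<open>g + e\<close> plus a quarter each of \<open>g \<bullet> g\<close> and
    \<open>e \<bullet> e\<close>. Multiplied by 4, this inequality yields the constants 4 and 3 of
    the final bound.\<close>
  ultimately have "(g \<bullet> g) / 4 - 3 / 4 * (e \<bullet> e) \<le> v \<bullet> g - (norm v)\<^sup>2 / 8"
    using inner_ge_zero[of e] inner_ge_zero[of g] by linarith
  from mult_left_mono[OF this, of \<eta>] step \<eta>(1)
  have "f (x - \<eta> *\<^sub>R v) \<le> f x - \<eta> * ((g \<bullet> g) / 4 - 3 / 4 * (e \<bullet> e))" by linarith
  then show ?thesis
    unfolding power2_norm_eq_inner g_def[symmetric] e_def[symmetric]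
    by (simp add: algebra_simps)
qed

text \<open>The function values telescope, and the last one, \<open>f (w T)\<close>, is at least the
  infimum. The directions \<open>v k\<close> are arbitrary; nothing about the plant enters
  yet.\<close>

lemma inexact_descent_sum:
  fixes f :: "'a::euclidean_space \<Rightarrow> real"
  assumes "f differentiable_on UNIV"
    and "L-lipschitz_on UNIV (gradient f)"
    and bdd: "bdd_below (range f)"
    and "0 < \<eta>" "L * \<eta> \<le> 1 / 4"
    and w: "\<And>k. w (Suc k) = w k - \<eta> *\<^sub>R v k"
  shows "\<eta> * (\<Sum>k<T. (norm (gradient f (w k)))\<^sup>2)
      \<le> 4 * (f (w 0) - (INF u. f u)) + 3 * \<eta> * (\<Sum>k<T. (norm (v k - gradient f (w k)))\<^sup>2)"
proof -
  have "\<eta> * (\<Sum>k<T. (norm (gradient f (w k)))\<^sup>2)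
      \<le> (\<Sum>k<T. 4 * (f (w k) - f (w (Suc k))) + 3 * \<eta> * (norm (v k - gradient f (w k)))\<^sup>2)"
    unfolding sum_distrib_left w by (intro sum_mono inexact_descent_step[where L = L] assms)
  also have "\<dots> = 4 * (f (w 0) - f (w T)) + 3 * \<eta> * (\<Sum>k<T. (norm (v k - gradient f (w k)))\<^sup>2)"
    using sum_lessThan_telescope'[of "\<lambda>k. f (w k)" T]
    by (simp only: sum.distrib sum_distrib_left[symmetric])
  also have "(INF u. f u) \<le> f (w T)"
    using bdd by (intro cINF_lower) auto
  then have "4 * (f (w 0) - f (w T)) \<le> 4 * (f (w 0) - (INF u. f u))" by simp
  finally show ?thesis by simp
qed

section \<open>The closed loop\<close>

text \<open>Chain rule through \<open>u \<mapsto> (u, h (u, d))\<close>: the derivative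
  \<open>D\<close> of \<open>\<Phi>\<close> splits into its two partial derivatives, each
  represented by a partial gradient.\<close>

lemma gradient_reduced_obj:
  fixes \<Phi> :: "(real^'p) \<times> (real^'q) \<Rightarrow> real" and h :: "(real^'p) \<times> (real^'r) \<Rightarrow> real^'q"
  assumes d\<Phi>: "\<Phi> differentiable_on UNIV" and dh: "(\<lambda>u. h (u, d)) differentiable_on UNIV"
  shows "gradient (reduced_obj \<Phi> h d) u
    = grad_u \<Phi> u (h (u, d)) + sensitivity h d u *v grad_y \<Phi> u (h (u, d))"
proof (rule gradient_eqI)
  define y where "y = h (u, d)"
  define J where "J = jacobian (\<lambda>u. h (u, d)) (at u)"
  obtain D where D: "(\<Phi> has_derivative D) (at (u, y))"
    using d\<Phi> by (auto simp: differentiable_on_def differentiable_def)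
  have "((\<lambda>u. (u, y)) has_derivative (\<lambda>a. (a, 0))) (at u)"
    by (auto intro!: derivative_eq_intros)
  from has_derivative_compose[OF this D]
  have Du: "((\<lambda>u. \<Phi> (u, y)) has_derivative (\<lambda>a. D (a, 0))) (at u)" .
  then have "GDERIV (\<lambda>u. \<Phi> (u, y)) u :> grad_u \<Phi> u y"
    unfolding grad_u_def by (intro GDERIV_gradient differentiableI)
  with Du have Du: "D (a, 0) = a \<bullet> grad_u \<Phi> u y" for a
    unfolding gderiv_def by (metis has_derivative_unique)
  have "((\<lambda>y. (u, y)) has_derivative (\<lambda>b. (0, b))) (at y)"
    by (auto intro!: derivative_eq_intros)
  from has_derivative_compose[OF this D]
  have Dy: "((\<lambda>y. \<Phi> (u, y)) has_derivative (\<lambda>b. D (0, b))) (at y)" .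
  then have "GDERIV (\<lambda>y. \<Phi> (u, y)) y :> grad_y \<Phi> u y"
    unfolding grad_y_def by (intro GDERIV_gradient differentiableI)
  with Dy have Dy: "D (0, b) = b \<bullet> grad_y \<Phi> u y" for b
    unfolding gderiv_def by (metis has_derivative_unique)
  have "((\<lambda>u. h (u, d)) has_derivative (*v) J) (at u)"
    using dh jacobian_works[of "\<lambda>u. h (u, d)" "at u"] by (auto simp: J_def differentiable_on_def)
  then have "((\<lambda>u. (u, h (u, d))) has_derivative (\<lambda>a. (a, J *v a))) (at u)"
    by (intro has_derivative_Pair has_derivative_ident)
  from has_derivative_compose[OF this, of \<Phi> D] D
  have "(reduced_obj \<Phi> h d has_derivative (\<lambda>a. D (a, J *v a))) (at u)"
    by (simp add: reduced_obj_def[abs_def] y_def)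
  moreover have "D (a, J *v a) = a \<bullet> (grad_u \<Phi> u y + sensitivity h d u *v grad_y \<Phi> u y)" for a
  proof -
    have "D (a, J *v a) = D (a, 0) + D (0, J *v a)"
      using linear_add[OF has_derivative_linear[OF D], of "(a, 0)" "(0, J *v a)"] by simp
    \<comment> \<open>Moving \<open>J\<close> across the inner product transposes it, which is why
      the sensitivity is the transposed Jacobian.\<close>
    moreover have "(J *v a) \<bullet> grad_y \<Phi> u y = a \<bullet> (transpose J *v grad_y \<Phi> u y)"
      by (metis dot_lmul_matrix inner_commute transpose_matrix_vector)
    ultimately show ?thesis
      by (simp add: Du Dy inner_add_right sensitivity_def J_def del: transpose_matrix_vector)
  qed
  ultimately show "GDERIV (reduced_obj \<Phi> h d) u
      :> grad_u \<Phi> u (h (u, d)) + sensitivity h d u *v grad_y \<Phi> u (h (u, d))"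
    by (simp add: gderiv_def y_def)
qed

lemma sens_error_nonneg: "0 \<le> sens_error h d H w k"
  unfolding sens_error_def by (intro onorm_pos_le matrix_vector_mul_bounded_linear)

text \<open>An instance of \<open>inexact_descent_sum\<close> whose direction error is controlled by
  the sensitivity error; dividing by \<open>\<eta> * real T\<close> gives the averaged form.\<close>

lemma closed_loop_bound:
  fixes \<Phi> :: "(real^'p) \<times> (real^'q) \<Rightarrow> real" and h :: "(real^'p) \<times> (real^'r) \<Rightarrow> real^'q"
  assumes L: "0 < L" and prob: "steady_state_problem \<Phi> h d L M M\<Phi>"
    and \<eta>: "0 < \<eta>" "\<eta> \<le> 1 / (4 * L)" and loop: "closed_loop \<Phi> h d H \<eta> w0 w y"
    and T: "T \<ge> 1"
  shows "avg_sq_grad \<Phi> h d w T \<le> error_bound M\<Phi> (initial_gap \<Phi> h d w0) \<eta> (sens_error h d H w) T"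
proof -
  note prob = prob[unfolded steady_state_problem_def]
  let ?f = "reduced_obj \<Phi> h d" and ?\<epsilon> = "sens_error h d H w"
  define v where "v k = grad_u \<Phi> (w k) (y k) + H k *v grad_y \<Phi> (w k) (y k)" for k
  have w0: "w 0 = w0" and y: "y k = h (w k, d)" and w: "w (Suc k) = w k - \<eta> *\<^sub>R v k" for k
    using loop by (auto simp: closed_loop_def v_def)
  have err: "(norm (v k - gradient ?f (w k)))\<^sup>2 \<le> M\<Phi>\<^sup>2 * (?\<epsilon> k)\<^sup>2" for k
  proof -
    let ?A = "H k - sensitivity h d (w k)" and ?g = "grad_y \<Phi> (w k) (y k)"
    \<comment> \<open>Since \<open>y k\<close> is the exact steady-state output, the
      \<open>grad_u\<close> terms agree and cancel.\<close>
    have "v k - gradient ?f (w k) = ?A *v ?g"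
      using prob by (simp add: gradient_reduced_obj v_def y matrix_vector_mult_diff_rdistrib)
    then have "norm (v k - gradient ?f (w k)) \<le> ?\<epsilon> k * norm ?g"
      unfolding sens_error_def by (simp add: onorm)
    \<comment> \<open>Partial differentiability in \<open>y\<close>, inherited from
      \<open>\<Phi>\<close>, lets the Lipschitz constant bound \<open>?g\<close>.\<close>
    also have "(\<lambda>y. \<Phi> (w k, y)) differentiable (at (y k))"
    proof -
      have "\<Phi> differentiable (at (w k, y k))"
        using prob by (auto simp: differentiable_on_def)
      moreover have "(\<lambda>y. (w k, y)) differentiable (at (y k))"
        by (intro differentiableI[where f' = "\<lambda>b. (0, b)"]) (auto intro!: derivative_eq_intros)
      ultimately show ?thesis
        using differentiable_chain_at[of "\<lambda>y. (w k, y)" "y k" \<Phi>] by (simp add: o_def)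
    qed
    then have "norm ?g \<le> M\<Phi>"
      unfolding grad_y_def using prob by (intro norm_gradient_le_lipschitz) auto
    then have "?\<epsilon> k * norm ?g \<le> ?\<epsilon> k * M\<Phi>"
      by (intro mult_left_mono sens_error_nonneg)
    finally show ?thesis
      by (metis mult.commute norm_ge_zero power_mono power_mult_distrib)
  qed
  have "L * \<eta> \<le> 1 / 4" using \<eta> L by (simp add: field_simps)
  with prob \<eta>(1) w have "\<eta> * (\<Sum>k<T. (norm (gradient ?f (w k)))\<^sup>2)
      \<le> 4 * (?f (w 0) - (INF u. ?f u)) + 3 * \<eta> * (\<Sum>k<T. (norm (v k - gradient ?f (w k)))\<^sup>2)"
    by (intro inexact_descent_sum) auto
  also have "\<dots> \<le> 4 * initial_gap \<Phi> h d w0 + 3 * \<eta> * (M\<Phi>\<^sup>2 * (\<Sum>k<T. (?\<epsilon> k)\<^sup>2))"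
    using \<eta>(1) err by (auto simp: initial_gap_def w0 sum_distrib_left intro!: sum_mono)
  finally show ?thesis
    using \<eta>(1) T by (simp add: avg_sq_grad_def error_bound_def field_simps)
qed

section \<open>Rates\<close>

text \<open>For exponents above 1 the series converges, so its value bounds all partial sums
  uniformly in \<open>T\<close>.\<close>

lemma sum_powr_le_suminf:
  assumes "1 < (a::real)"
  shows "(\<Sum>k<T. (real k + 1) powr - a) \<le> (\<Sum>k. (real k + 1) powr - a)"
proof (rule sum_le_suminf)
  \<comment> \<open>Shifting the index by one preserves summability.\<close>
  have "summable (\<lambda>k. real (Suc k) powr - a)"
    using assms summable_real_powr_iff[of "- a"] by (subst summable_Suc_iff) simp
  then show "summable (\<lambda>k. (real k + 1) powr - a)" by (simp add: add.commute)
qed auto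

text \<open>By induction: each new term is at most the increment of the right-hand side. Young's
  inequality proves this in place of a comparison with an integral.\<close>

lemma sum_powr_le_powr:
  assumes "0 \<le> a" "a < (1::real)"
  shows "(\<Sum>k<T. (real k + 1) powr - a) \<le> real T powr (1 - a) / (1 - a)"
proof (induction T)
  case (Suc n)
  have "real n powr (1 - a) + (1 - a) * (real n + 1) powr - a \<le> (real n + 1) powr (1 - a)"
  proof (cases "n = 0")
    case False
    \<comment> \<open>Weighted arithmetic-geometric mean of \<open>n\<close> and
      \<open>n + 1\<close> with weights \<open>1 - a\<close> and \<open>a\<close>; the right side is
      \<open>n + a\<close>.\<close>
    have "real n powr (1 - a) * (real n + 1) powr a \<le> (1 - a) * real n + a * (real n + 1)"
      using False assms by (intro Youngs_inequality_0) auto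
    then have "real n powr (1 - a) \<le> (real n + a) / (real n + 1) powr a"
      by (simp add: field_simps)
    moreover have "(real n + 1) powr (1 - a) = (real n + 1) / (real n + 1) powr a"
      by (simp add: powr_diff)
    ultimately show ?thesis
      by (simp add: powr_minus_divide add_divide_distrib diff_divide_distrib left_diff_distrib)
  qed (use assms in auto)
  then have "(real n powr (1 - a) + (1 - a) * (real n + 1) powr - a) / (1 - a)
      \<le> (real n + 1) powr (1 - a) / (1 - a)"
    using assms by (intro divide_right_mono) auto
  then have "real n powr (1 - a) / (1 - a) + (real n + 1) powr - a
      \<le> (real n + 1) powr (1 - a) / (1 - a)"
    using assms by (simp add: add_divide_distrib)
  with Suc show ?case by (simp add: add.commute)
qed simp

text \<open>The sum is the harmonic number, at most \<open>1 + ln T\<close>. From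
  \<open>T = 3\<close> on, \<open>ln T\<close> is at least 1 because \<open>exp 1 \<le> 3\<close>,
  so it absorbs the summand 1.\<close>

lemma sum_powr_le_ln:
  assumes "3 \<le> T"
  shows "(\<Sum>k<T. (real k + 1) powr - 1) \<le> 2 * ln (real T)"
proof -
  obtain n where n: "T = Suc n" using assms by (cases T) auto
  have "(\<Sum>k<T. (real k + 1) powr - 1) = (harm T :: real)"
    unfolding harm_altdef by (intro sum.cong) (auto simp: powr_minus add.commute)
  \<comment> \<open>The difference decreases from its value 1 at \<open>T = 1\<close>, which is
    index 0 of the library sequence.\<close>
  also have "harm T - ln (real T) \<le> 1"
    using decseqD[OF decseq_harm_diff_ln, of 0 n] by (simp add: n harm_Suc harm_expand(1))
  then have "harm T \<le> 1 + ln (real T)" by simp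
  also have "1 \<le> ln (real T)"
    using assms exp_le by (subst ln_ge_iff) auto
  then have "1 + ln (real T) \<le> 2 * ln (real T)" by simp
  finally show ?thesis .
qed

text \<open>Common last step of all rates: \<open>\<rho>\<close> is the rate at a fixed
  \<open>T\<close> and must dominate both \<open>1 / T\<close>, for the gap term, and the averaged
  squared errors up to \<open>K\<close>. The summand 1 keeps the constant positive when the gap and
  \<open>M\<Phi>\<close> vanish.\<close>

lemma error_bound_le:
  assumes pos: "0 < L" "0 \<le> \<Delta>" and T: "T \<ge> 1"
    and e: "\<And>k. 0 \<le> e k" "\<And>k. e k \<le> b k"
    and sum: "(\<Sum>k<T. (b k)\<^sup>2) / real T \<le> K * \<rho>" and \<rho>: "1 / real T \<le> \<rho>"
  shows "error_bound M\<Phi> \<Delta> (1 / (4 * L)) e T \<le> (16 * L * \<Delta> + 3 * M\<Phi>\<^sup>2 * K + 1) * \<rho>"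
proof -
  have "(\<Sum>k<T. (e k)\<^sup>2) \<le> (\<Sum>k<T. (b k)\<^sup>2)"
    using e by (intro sum_mono power_mono)
  then have "(\<Sum>k<T. (e k)\<^sup>2) / real T \<le> (\<Sum>k<T. (b k)\<^sup>2) / real T"
    by (simp add: divide_right_mono)
  also note sum
  finally have "3 * M\<Phi>\<^sup>2 * ((\<Sum>k<T. (e k)\<^sup>2) / real T) \<le> 3 * M\<Phi>\<^sup>2 * (K * \<rho>)"
    by (intro mult_left_mono) auto
  moreover have "16 * L * \<Delta> * (1 / real T) \<le> 16 * L * \<Delta> * \<rho>"
    using pos \<rho> by (intro mult_left_mono) auto
  moreover have "0 \<le> \<rho>" using \<rho> order_trans[of 0 "1 / real T" \<rho>] by simp
  ultimately show ?thesis
    by (simp add: error_bound_def algebra_simps)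
qed

lemma sum_sq_powr:
  fixes \<epsilon>' \<theta> :: real
  shows "(\<Sum>k<T. (\<epsilon>' / (real k + 1) powr \<theta>)\<^sup>2) = \<epsilon>'\<^sup>2 * (\<Sum>k<T. (real k + 1) powr - (2 * \<theta>))"
proof -
  have "((real k + 1) powr \<theta>)\<^sup>2 = (real k + 1) powr (2 * \<theta>)" for k
    by (simp add: powr_power mult.commute)
  then show ?thesis
    by (simp add: sum_distrib_left power_divide powr_minus_divide)
qed

text \<open>If \<open>2 * \<theta> < 1\<close>, the sum grows like
  \<open>T powr (1 - 2 * \<theta>)\<close>; if \<open>2 * \<theta> > 1\<close>, it stays bounded.
  Division by \<open>T\<close> gives the two branches of the minimum.\<close>

lemma sum_powr_avg_le:
  fixes \<theta> :: real
  assumes "0 < \<theta>" "\<theta> \<noteq> 1 / 2"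
  shows "\<exists>K\<ge>0. \<forall>T\<ge>1. (\<Sum>k<T. (\<epsilon>' / (real k + 1) powr \<theta>)\<^sup>2) / real T
    \<le> K * (1 / real T powr min 1 (2 * \<theta>))"
proof -
  obtain S where S: "0 \<le> S" "\<And>T. T \<ge> 1 \<Longrightarrow>
      (\<Sum>k<T. (real k + 1) powr - (2 * \<theta>)) / real T \<le> S * (1 / real T powr min 1 (2 * \<theta>))"
  proof (cases "\<theta> < 1 / 2")
    case True
    show ?thesis
    proof (rule that[of "1 / (1 - 2 * \<theta>)"])
      fix T :: nat assume "T \<ge> 1"
      have "(\<Sum>k<T. (real k + 1) powr - (2 * \<theta>)) / real T
          \<le> (real T powr (1 - 2 * \<theta>) / (1 - 2 * \<theta>)) / real T"
        using True assms by (intro divide_right_mono sum_powr_le_powr) auto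
      also have "\<dots> = 1 / (1 - 2 * \<theta>) * (1 / real T powr min 1 (2 * \<theta>))"
        using True \<open>T \<ge> 1\<close> by (simp add: powr_diff)
      finally show "(\<Sum>k<T. (real k + 1) powr - (2 * \<theta>)) / real T
          \<le> 1 / (1 - 2 * \<theta>) * (1 / real T powr min 1 (2 * \<theta>))" .
    qed (use True in simp)
  next
    case False
    show ?thesis
    proof (rule that[of "\<Sum>k. (real k + 1) powr - (2 * \<theta>)"])
      fix T :: nat assume "T \<ge> 1"
      then show "(\<Sum>k<T. (real k + 1) powr - (2 * \<theta>)) / real T
          \<le> (\<Sum>k. (real k + 1) powr - (2 * \<theta>)) * (1 / real T powr min 1 (2 * \<theta>))"
        using False assms sum_powr_le_suminf[of "2 * \<theta>" T] by (simp add: min_def divide_right_mono)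
    next
      \<comment> \<open>The empty partial sum, \<open>T = 0\<close>, is below the value of the
        series.\<close>
      show "0 \<le> (\<Sum>k. (real k + 1) powr - (2 * \<theta>))"
        using False assms sum_powr_le_suminf[of "2 * \<theta>" 0] by simp
    qed
  qed
  have "(\<Sum>k<T. (\<epsilon>' / (real k + 1) powr \<theta>)\<^sup>2) / real T
      \<le> \<epsilon>'\<^sup>2 * S * (1 / real T powr min 1 (2 * \<theta>))" if "T \<ge> 1" for T
    using mult_left_mono[OF S(2)[OF that], of "\<epsilon>'\<^sup>2"] by (simp add: sum_sq_powr)
  with S(1) show ?thesis by (intro exI[of _ "\<epsilon>'\<^sup>2 * S"]) simp
qed

text \<open>Serves both power-law cases of the theorem, above and below one third. The constant is
  fixed before the error sequence \<open>e\<close>.\<close>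

lemma error_bound_powr_rate:
  fixes \<theta> :: real
  assumes "0 < L" "0 \<le> \<Delta>" "0 < \<theta>" "\<theta> \<noteq> 1 / 2"
  shows "\<exists>C>0. \<forall>e. (\<forall>k. 0 \<le> e k \<and> e k \<le> \<epsilon>' / (real k + 1) powr \<theta>) \<longrightarrow>
    (\<forall>T\<ge>1. error_bound M\<Phi> \<Delta> (1 / (4 * L)) e T \<le> C * (1 / real T powr min 1 (2 * \<theta>)))"
proof -
  obtain K where K: "0 \<le> K" "\<And>T. T \<ge> 1 \<Longrightarrow> (\<Sum>k<T. (\<epsilon>' / (real k + 1) powr \<theta>)\<^sup>2) / real T
      \<le> K * (1 / real T powr min 1 (2 * \<theta>))"
    using sum_powr_avg_le[OF assms(3,4)] by blast
  show ?thesis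
  proof (intro exI conjI allI impI)
    show "0 < 16 * L * \<Delta> + 3 * M\<Phi>\<^sup>2 * K + 1"
      using assms(1,2) K(1) by (intro add_nonneg_pos add_nonneg_nonneg) auto
    fix e :: "nat \<Rightarrow> real" and T :: nat
    assume e: "\<forall>k. 0 \<le> e k \<and> e k \<le> \<epsilon>' / (real k + 1) powr \<theta>" and T: "T \<ge> 1"
    \<comment> \<open>The exponent is at most 1, so the gap term decays at least as fast as the
      rate.\<close>
    have "1 / real T \<le> 1 / real T powr min 1 (2 * \<theta>)"
      using T powr_mono[of "min 1 (2 * \<theta>)" 1 "real T"] by (auto intro!: frac_le)
    then show "error_bound M\<Phi> \<Delta> (1 / (4 * L)) e T
        \<le> (16 * L * \<Delta> + 3 * M\<Phi>\<^sup>2 * K + 1) * (1 / real T powr min 1 (2 * \<theta>))"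
      using e by (intro error_bound_le[OF assms(1,2) T _ _ K(2)[OF T]]) auto
  qed
qed

lemma error_bound_ln_rate:
  assumes "0 < L" "0 \<le> \<Delta>"
  shows "\<exists>C>0. \<forall>e. (\<forall>k. 0 \<le> e k \<and> e k \<le> \<epsilon>' / (real k + 1) powr (1 / 2)) \<longrightarrow>
    (\<forall>T\<ge>3. error_bound M\<Phi> \<Delta> (1 / (4 * L)) e T \<le> C * (ln (real T) / real T))"
proof -
  \<comment> \<open>The 2 is the factor in \<open>sum_powr_le_ln\<close>.\<close>
  define K where "K = 2 * \<epsilon>'\<^sup>2"
  have K: "(\<Sum>k<T. (\<epsilon>' / (real k + 1) powr (1 / 2))\<^sup>2) / real T \<le> K * (ln (real T) / real T)"
    if "T \<ge> 3" for T
    using mult_left_mono[OF sum_powr_le_ln[OF that], of "\<epsilon>'\<^sup>2"]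
    by (simp add: sum_sq_powr K_def divide_right_mono mult.left_commute)
  show ?thesis
  proof (intro exI conjI allI impI)
    show "0 < 16 * L * \<Delta> + 3 * M\<Phi>\<^sup>2 * K + 1"
      using assms by (intro add_nonneg_pos add_nonneg_nonneg) (auto simp: K_def)
    fix e :: "nat \<Rightarrow> real" and T :: nat
    assume e: "\<forall>k. 0 \<le> e k \<and> e k \<le> \<epsilon>' / (real k + 1) powr (1 / 2)" and T: "T \<ge> 3"
    have "1 \<le> ln (real T)" using T exp_le by (subst ln_ge_iff) auto
    then have "1 / real T \<le> ln (real T) / real T" by (simp add: divide_right_mono)
    then show "error_bound M\<Phi> \<Delta> (1 / (4 * L)) e T
        \<le> (16 * L * \<Delta> + 3 * M\<Phi>\<^sup>2 * K + 1) * (ln (real T) / real T)"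
      using T e by (intro error_bound_le[OF assms _ _ _ K[OF T]]) auto
  qed
qed

text \<open>The average of the constant \<open>\<epsilon>\<^sup>2\<close> is itself, so
  \<open>K = 1\<close> works and the constant can be chosen before
  \<open>\<epsilon>\<close>.\<close>

lemma error_bound_bounded_rate:
  assumes "0 < L" "0 \<le> \<Delta>"
  shows "\<exists>C>0. \<forall>\<epsilon>>0. \<forall>e. (\<forall>k. 0 \<le> e k \<and> e k \<le> \<epsilon>) \<longrightarrow>
    (\<forall>T\<ge>1. error_bound M\<Phi> \<Delta> (1 / (4 * L)) e T \<le> C * (1 / real T + \<epsilon>\<^sup>2))"
proof -
  show ?thesis
  proof (intro exI conjI allI impI)
    show "0 < 16 * L * \<Delta> + 3 * M\<Phi>\<^sup>2 * 1 + 1"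
      using assms by (intro add_nonneg_pos add_nonneg_nonneg) auto
    fix \<epsilon> :: real and e :: "nat \<Rightarrow> real" and T :: nat
    assume "\<forall>k. 0 \<le> e k \<and> e k \<le> \<epsilon>" and "T \<ge> 1"
    then show "error_bound M\<Phi> \<Delta> (1 / (4 * L)) e T
        \<le> (16 * L * \<Delta> + 3 * M\<Phi>\<^sup>2 * 1 + 1) * (1 / real T + \<epsilon>\<^sup>2)"
      using assms by (intro error_bound_le[where b = "\<lambda>_. \<epsilon>"]) auto
  qed
qed

text \<open>Sensitivity errors are nonnegative, hence admissible for \<open>e\<close>, and a rate
  for the right-hand side passes to the closed loop. The bound \<open>\<rho>\<close> precedes the
  problem data, so it is uniform over them.\<close>

lemma closed_loop_rate:
  assumes rate: "\<forall>e. (\<forall>k. 0 \<le> e k \<and> e k \<le> b k) \<longrightarrow>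
      (\<forall>T\<ge>T0. error_bound M\<Phi> \<Delta> (1 / (4 * L)) e T \<le> \<rho> T)"
    and L: "0 < L" and T0: "1 \<le> T0"
  shows "\<forall>(\<Phi> :: (real^'p) \<times> (real^'q) \<Rightarrow> real) (h :: (real^'p) \<times> (real^'r) \<Rightarrow> real^'q) d M H w0 w y.
    steady_state_problem \<Phi> h d L M M\<Phi> \<and> initial_gap \<Phi> h d w0 = \<Delta> \<and>
    closed_loop \<Phi> h d H (1 / (4 * L)) w0 w y \<and> (\<forall>k. sens_error h d H w k \<le> b k) \<longrightarrow>
    (\<forall>T\<ge>T0. avg_sq_grad \<Phi> h d w T \<le> \<rho> T)"
proof (intro allI impI; elim conjE)
  fix \<Phi> :: "(real^'p) \<times> (real^'q) \<Rightarrow> real" and h :: "(real^'p) \<times> (real^'r) \<Rightarrow> real^'q"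
  fix d M H w0 w y T
  assume prob: "steady_state_problem \<Phi> h d L M M\<Phi>" and gap: "initial_gap \<Phi> h d w0 = \<Delta>"
    and loop: "closed_loop \<Phi> h d H (1 / (4 * L)) w0 w y"
    and err: "\<forall>k. sens_error h d H w k \<le> b k" and T: "T0 \<le> T"
  have "avg_sq_grad \<Phi> h d w T \<le> error_bound M\<Phi> \<Delta> (1 / (4 * L)) (sens_error h d H w) T"
    using closed_loop_bound[OF L prob _ _ loop, of T] L T0 T gap by simp
  also have "\<dots> \<le> \<rho> T"
    using rate err sens_error_nonneg T by blast
  finally show "avg_sq_grad \<Phi> h d w T \<le> \<rho> T" .
qed

theorem theorem4:
  shows
   "(\<forall>(\<Phi> :: (real^'p) \<times> (real^'q) \<Rightarrow> real) (h :: (real^'p) \<times> (real^'r) \<Rightarrow> real^'q) d L M M\<Phi> \<eta> H w0 w y.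
      0 < L \<and> steady_state_problem \<Phi> h d L M M\<Phi> \<and>
      0 < \<eta> \<and> \<eta> \<le> 1 / (4 * L) \<and> closed_loop \<Phi> h d H \<eta> w0 w y \<longrightarrow>
      (\<forall>T\<ge>1. avg_sq_grad \<Phi> h d w T
         \<le> error_bound M\<Phi> (initial_gap \<Phi> h d w0) \<eta> (sens_error h d H w) T))
    \<and>
    (\<forall>L M\<Phi> \<Delta>. 0 < L \<and> 0 \<le> M\<Phi> \<and> 0 \<le> \<Delta> \<longrightarrow>
      (\<forall>\<epsilon>' \<theta>. 0 < \<epsilon>' \<and> 1/3 \<le> \<theta> \<and> \<theta> \<noteq> 1/2 \<longrightarrow>
        (\<exists>C>0. \<exists>T0.
          (\<forall>e. (\<forall>k. 0 \<le> e k \<and> e k \<le> \<epsilon>' / (real k + 1) powr \<theta>) \<longrightarrow>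
             (\<forall>T\<ge>T0. error_bound M\<Phi> \<Delta> (1 / (4 * L)) e T \<le> C * (1 / real T powr min 1 (2 * \<theta>)))) \<and>
          (\<forall>(\<Phi> :: (real^'p) \<times> (real^'q) \<Rightarrow> real) (h :: (real^'p) \<times> (real^'r) \<Rightarrow> real^'q) d M H w0 w y.
             steady_state_problem \<Phi> h d L M M\<Phi> \<and> initial_gap \<Phi> h d w0 = \<Delta> \<and>
             closed_loop \<Phi> h d H (1 / (4 * L)) w0 w y \<and>
             (\<forall>k. sens_error h d H w k \<le> \<epsilon>' / (real k + 1) powr \<theta>) \<longrightarrow>
             (\<forall>T\<ge>T0. avg_sq_grad \<Phi> h d w T \<le> C * (1 / real T powr min 1 (2 * \<theta>)))))) \<and>
      (\<forall>\<epsilon>' \<theta>. 0 < \<epsilon>' \<and> \<theta> = 1/2 \<longrightarrow>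
        (\<exists>C>0. \<exists>T0.
          (\<forall>e. (\<forall>k. 0 \<le> e k \<and> e k \<le> \<epsilon>' / (real k + 1) powr \<theta>) \<longrightarrow>
             (\<forall>T\<ge>T0. error_bound M\<Phi> \<Delta> (1 / (4 * L)) e T \<le> C * (ln (real T) / real T))) \<and>
          (\<forall>(\<Phi> :: (real^'p) \<times> (real^'q) \<Rightarrow> real) (h :: (real^'p) \<times> (real^'r) \<Rightarrow> real^'q) d M H w0 w y.
             steady_state_problem \<Phi> h d L M M\<Phi> \<and> initial_gap \<Phi> h d w0 = \<Delta> \<and>
             closed_loop \<Phi> h d H (1 / (4 * L)) w0 w y \<and>
             (\<forall>k. sens_error h d H w k \<le> \<epsilon>' / (real k + 1) powr \<theta>) \<longrightarrow>
             (\<forall>T\<ge>T0. avg_sq_grad \<Phi> h d w T \<le> C * (ln (real T) / real T))))) \<and>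
      ((\<exists>C>0. \<exists>T0. \<forall>\<epsilon>>0.
          (\<forall>e. (\<forall>k. 0 \<le> e k \<and> e k \<le> \<epsilon>) \<longrightarrow>
             (\<forall>T\<ge>T0. error_bound M\<Phi> \<Delta> (1 / (4 * L)) e T \<le> C * (1 / real T + \<epsilon>\<^sup>2))) \<and>
          (\<forall>(\<Phi> :: (real^'p) \<times> (real^'q) \<Rightarrow> real) (h :: (real^'p) \<times> (real^'r) \<Rightarrow> real^'q) d M H w0 w y.
             steady_state_problem \<Phi> h d L M M\<Phi> \<and> initial_gap \<Phi> h d w0 = \<Delta> \<and>
             closed_loop \<Phi> h d H (1 / (4 * L)) w0 w y \<and>
             (\<forall>k. sens_error h d H w k \<le> \<epsilon>) \<longrightarrow>
             (\<forall>T\<ge>T0. avg_sq_grad \<Phi> h d w T \<le> C * (1 / real T + \<epsilon>\<^sup>2))))) \<and>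
      (\<forall>\<epsilon>' \<theta>. 0 < \<epsilon>' \<and> 0 < \<theta> \<and> \<theta> < 1/3 \<longrightarrow>
        (\<exists>C>0. \<exists>T0.
          (\<forall>e. (\<forall>k. 0 \<le> e k \<and> e k \<le> \<epsilon>' / (real k + 1) powr \<theta>) \<longrightarrow>
             (\<forall>T\<ge>T0. error_bound M\<Phi> \<Delta> (1 / (4 * L)) e T \<le> C * (1 / real T powr (2 * \<theta>)))) \<and>
          (\<forall>(\<Phi> :: (real^'p) \<times> (real^'q) \<Rightarrow> real) (h :: (real^'p) \<times> (real^'r) \<Rightarrow> real^'q) d M H w0 w y.
             steady_state_problem \<Phi> h d L M M\<Phi> \<and> initial_gap \<Phi> h d w0 = \<Delta> \<and>
             closed_loop \<Phi> h d H (1 / (4 * L)) w0 w y \<and>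
             (\<forall>k. sens_error h d H w k \<le> \<epsilon>' / (real k + 1) powr \<theta>) \<longrightarrow>
             (\<forall>T\<ge>T0. avg_sq_grad \<Phi> h d w T \<le> C * (1 / real T powr (2 * \<theta>)))))))"
proof ((rule conjI; (intro allI impI)?), goal_cases)
  case 1
  then show ?case by (intro closed_loop_bound) auto
next
  case (2 L M\<Phi> \<Delta>)
  then have L: "0 < L" and \<Delta>: "0 \<le> \<Delta>" by auto
  show ?case
  \<comment> \<open>The four error regimes; one constant and one threshold serve both the bound and
    the closed loop.\<close>
  proof ((intro conjI; (intro allI impI)?), goal_cases)
    case (1 \<epsilon>' \<theta>)
    then obtain C where "C > 0" and C: "\<forall>e. (\<forall>k. 0 \<le> e k \<and> e k \<le> \<epsilon>' / (real k + 1) powr \<theta>) \<longrightarrow>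
        (\<forall>T\<ge>1. error_bound M\<Phi> \<Delta> (1 / (4 * L)) e T \<le> C * (1 / real T powr min 1 (2 * \<theta>)))"
      using error_bound_powr_rate[OF L \<Delta>, of \<theta> \<epsilon>' M\<Phi>] by auto
    show ?case
      by (intro exI[of _ C] conjI exI[of _ "1::nat"] \<open>C > 0\<close> C closed_loop_rate[OF C L]) simp
  next
    case (2 \<epsilon>' \<theta>)
    then have "\<theta> = 1 / 2" by simp
    obtain C where "C > 0" and C: "\<forall>e. (\<forall>k. 0 \<le> e k \<and> e k \<le> \<epsilon>' / (real k + 1) powr (1 / 2)) \<longrightarrow>
        (\<forall>T\<ge>3. error_bound M\<Phi> \<Delta> (1 / (4 * L)) e T \<le> C * (ln (real T) / real T))"
      using error_bound_ln_rate[OF L \<Delta>, of \<epsilon>' M\<Phi>] by auto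
    show ?case
      unfolding \<open>\<theta> = 1 / 2\<close>
      by (intro exI[of _ C] conjI exI[of _ "3::nat"] \<open>C > 0\<close> C closed_loop_rate[OF C L]) simp
  next
    case 3
    \<comment> \<open>\<open>C\<close> is obtained before \<open>\<epsilon>\<close> is fixed, giving
      one constant for all error levels.\<close>
    obtain C where "C > 0" and C: "\<And>\<epsilon>. \<epsilon> > 0 \<Longrightarrow> \<forall>e. (\<forall>k. 0 \<le> e k \<and> e k \<le> \<epsilon>) \<longrightarrow>
        (\<forall>T\<ge>1. error_bound M\<Phi> \<Delta> (1 / (4 * L)) e T \<le> C * (1 / real T + \<epsilon>\<^sup>2))"
      using error_bound_bounded_rate[OF L \<Delta>, of M\<Phi>] by blast
    show ?case
    proof (rule exI[of _ C], rule conjI[OF \<open>C > 0\<close>], rule exI[of _ "1::nat"], rule allI, rule impI,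
        rule conjI, goal_cases)
      case (1 \<epsilon>)
      then show ?case by (rule C)
    next
      case (2 \<epsilon>)
      show ?case by (rule closed_loop_rate[OF C[OF 2] L order_refl])
    qed
  next
    case (4 \<epsilon>' \<theta>)
    \<comment> \<open>Below one third the minimum of 1 and \<open>2 * \<theta>\<close> is
      \<open>2 * \<theta>\<close>.\<close>
    then obtain C where "C > 0" and C: "\<forall>e. (\<forall>k. 0 \<le> e k \<and> e k \<le> \<epsilon>' / (real k + 1) powr \<theta>) \<longrightarrow>
        (\<forall>T\<ge>1. error_bound M\<Phi> \<Delta> (1 / (4 * L)) e T \<le> C * (1 / real T powr (2 * \<theta>)))"
      using error_bound_powr_rate[OF L \<Delta>, of \<theta> \<epsilon>' M\<Phi>] by auto
    show ?case
      by (intro exI[of _ C] conjI exI[of _ "1::nat"] \<open>C > 0\<close> C closed_loop_rate[OF C L]) simp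
  qed
qed

end
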